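(* Let $n\ge 2$ and let $p(x)=x^n+c_{n-1}x^{n-1}+\cdots+c_1x+c_0$ with $c_0=1$ and $c_1,\ldots,c_{n-1}\in\mathbb{R}$. Let $S$ be a striped companion matrix to $p(x)$, written as $$S=\left[\begin{array}{c|c}\mathbf{0}\;\; I_m & O\\ \hline R & \begin{matrix}I_{n-m-1}\\ \mathbf{0}^T\end{matrix}\end{array}\right].$$ If $\operatorname{rank}(R)=1$, then $\kappa(S)\le\kappa(F)$ for any Fiedler companion matrix $F$ to $p(x)$.
   Context: For a real $n\times n$ matrix $A=[a_{i,j}]$, $\|A\|=\sqrt{\sum_{i,j}a_{i,j}^2}$ is the Frobenius norm, and for invertible $A$, $\kappa(A)=\|A\|\cdot\|A^{-1}\|$. Two matrices are called equivalent if one is obtained from the other by transposition and/or permutation similarity. Fiedler companion matrices: let $F_0=\mathrm{diag}(1,\ldots,1,-c_0)$ and, for $1\le k\le n-1$, let $F_k$ be the block diagonal matrix with diagonal blocks $I_{n-k-1}$, $\begin{bmatrix}-c_k&1\\1&0\end{bmatrix}$, $I_{k-1}$ (in this order). A Fiedler companion matrix to $p(x)$ is a matrix equal (or equivalent) to a product $F_{\sigma_0}F_{\sigma_1}\cdots F_{\sigma_{n-1}}$ for some permutation $(\sigma_0,\ldots,\sigma_{n-1})$ of $\{0,1,\ldots,n-1\}$. Striped companion matrices: let $\mathbf{t}=(t_1,\ldots,t_r)$ be positive integers with $t_1+\cdots+t_r=n$ and $t_1\ge t_i$ for all $i$. The striped companion matrix $S_n(\mathbf{t})$ to $p(x)$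 is the $n\times n$ matrix with $1$ in every position $(i,i+1)$, $1\le i\le n-1$, whose remaining nonzero entries lie in the $(n-t_1+1)\times t_1$ submatrix $R$ formed by rows $t_1,\ldots,n$ and columns $1,\ldots,t_1$ (so $m=t_1-1$ in the block form in the claim). The matrix $R$ has $r$ designated rows (stripes): the first is row $1$ of $R$, and for $1<i\le r$ the $i$-th is preceded immediately by $t_i-1$ zero rows of $R$ (so the $i$-th stripe lies in row $t_1+\cdots+t_i$ of $S_n(\mathbf{t})$). The $i$-th stripe has coefficient entries in its first $t_i$ positions and zeros elsewhere; a coefficient entry in position $(p,q)$ of $S_n(\mathbf{t})$ equals $-c_{n-1-(p-q)}$. *)

theory Defs
  imports
    Complex_Main
    "HOL-Computational_Algebra.Polynomial"
    "HOL-Combinatorics.Permutations"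
    "Jordan_Normal_Form.Matrix"
    "Jordan_Normal_Form.Gauss_Jordan_Elimination"
    "Jordan_Normal_Form.DL_Rank"
begin

definition frobenius_norm :: "real mat \<Rightarrow> real" where
  "frobenius_norm A = sqrt (\<Sum>i<dim_row A. \<Sum>j<dim_col A. (A $$ (i, j))\<^sup>2)"

(* Meaningful for invertible A only: mat_inverse yields None for a singular matrix. *)
definition cond_number :: "real mat \<Rightarrow> real" where
  "cond_number A = frobenius_norm A * frobenius_norm (the (mat_inverse A))"

definition permutation_matrix :: "nat \<Rightarrow> (nat \<Rightarrow> nat) \<Rightarrow> real mat" where
  "permutation_matrix n \<pi> = mat n n (\<lambda>(i, j). if \<pi> i = j then 1 else 0)"

definition permutation_similar :: "real mat \<Rightarrow> real mat \<Rightarrow> bool" where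
  "permutation_similar A B \<longleftrightarrow>
     (\<exists>n \<pi>. A \<in> carrier_mat n n \<and> \<pi> permutes {..<n} \<and>
       B = permutation_matrix n \<pi> * A * transpose_mat (permutation_matrix n \<pi>))"

definition equivalent_mat :: "real mat \<Rightarrow> real mat \<Rightarrow> bool" where
  "equivalent_mat A B \<longleftrightarrow> permutation_similar A B \<or> permutation_similar (transpose_mat A) B"

definition fiedler_factor :: "nat \<Rightarrow> real poly \<Rightarrow> nat \<Rightarrow> real mat" where
  "fiedler_factor n p k =
     (if k = 0 then diag_block_mat [1\<^sub>m (n - 1), mat_of_rows_list 1 [[- coeff p 0]]]
      else diag_block_mat
        [1\<^sub>m (n - k - 1), mat_of_rows_list 2 [[- coeff p k, 1], [1, 0]], 1\<^sub>m (k - 1)])"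

definition fiedler_product :: "nat \<Rightarrow> real poly \<Rightarrow> nat list \<Rightarrow> real mat" where
  "fiedler_product n p \<sigma> = foldr (*) (map (fiedler_factor n p) \<sigma>) (1\<^sub>m n)"

definition is_fiedler_companion :: "nat \<Rightarrow> real poly \<Rightarrow> real mat \<Rightarrow> bool" where
  "is_fiedler_companion n p F \<longleftrightarrow>
     (\<exists>\<sigma>. distinct \<sigma> \<and> set \<sigma> = {..<n} \<and> equivalent_mat (fiedler_product n p \<sigma>) F)"

definition stripe_sizes :: "nat \<Rightarrow> nat list \<Rightarrow> bool" where
  "stripe_sizes n t \<longleftrightarrow>
     t \<noteq> [] \<and> (\<forall>x \<in> set t. 0 < x) \<and> sum_list t = n \<and> (\<forall>x \<in> set t. x \<le> hd t)"

(* Everything is 0-based here: t ! k is the size of the stripe with index k, which lies in the row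
   with index t ! 0 + ... + t ! k - 1.  No truncation occurs in the coefficient index: for
   coefficient entries, j < t ! k \<le> i + 1 and i < n. *)
definition striped_companion :: "nat \<Rightarrow> real poly \<Rightarrow> nat list \<Rightarrow> real mat" where
  "striped_companion n p t = mat n n (\<lambda>(i, j).
     if j = i + 1 then 1
     else if \<exists>k < length t. i + 1 = sum_list (take (k + 1) t) \<and> j < t ! k
     then - coeff p (n - 1 - (i - j))
     else 0)"

definition upper_shift_block :: "nat \<Rightarrow> real mat" where
  "upper_shift_block m = mat m (m + 1) (\<lambda>(i, j). if j = i + 1 then 1 else 0)"

definition lower_identity_block :: "nat \<Rightarrow> real mat" where
  "lower_identity_block k = mat (k + 1) k (\<lambda>(i, j). if i = j then 1 else 0)"

lemma take_sum_le:
  assumes "k < length t" shows "hd t + (if k = 0 then 0 else t ! k) \<le> sum_list (take (k + 1) (t :: nat list))"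
proof (cases t)
  case (Cons a s)
  show ?thesis
  proof (cases k)
    case (Suc l)
    with assms Cons have "s ! l \<in> set (take (Suc l) s)"
      by (metis Suc_less_eq length_Cons lessI less_eq_Suc_le in_set_conv_nth length_take min.absorb2 nth_take)
    from member_le_sum_list[OF this] Suc Cons show ?thesis by simp
  qed (use Cons in simp)
qed (use assms in simp)

(* In 1-based terms, R is the submatrix of rows t_1, ..., n and columns 1, ..., t_1; the only
   nonzero entries outside R are the ones on the superdiagonal. *)
lemma striped_companion_block_form:
  fixes t :: "nat list" and p :: "real poly"
  assumes "stripe_sizes n t"
  defines "m \<equiv> hd t - 1"
  defines "R \<equiv> mat (n - m) (m + 1) (\<lambda>(i, j). striped_companion n p t $$ (i + m, j))"
  shows "striped_companion n p t =
    four_block_mat (upper_shift_block m) (0\<^sub>m m (n - m - 1)) R (lower_identity_block (n - m - 1))"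
proof -
  have hd: "0 < hd t" "hd t \<le> n" "t \<noteq> []"
    using assms(1) member_le_sum_list[of "hd t" t] by (auto simp: stripe_sizes_def)
  have mn: "m < n" "hd t = m + 1" using hd by (auto simp: m_def)
  have row: "m \<le> i" if "k < length t" "i + 1 = sum_list (take (k + 1) t)" for i k
    using take_sum_le[OF that(1)] that(2) mn by linarith
  have col: "j \<le> m" if "k < length t" "j < t ! k" for j k
  proof -
    have "t ! k \<le> hd t" using assms(1) that(1) by (auto simp: stripe_sizes_def)
    with that mn show ?thesis by simp
  qed
  show ?thesis
  proof (rule eq_matI, goal_cases)
    case (1 i j)
    then have ij: "i < n" "j < n"
      using mn by (auto simp: upper_shift_block_def lower_identity_block_def)
    show ?case
    proof (cases "i < m")
      case True
      then have "\<not> (\<exists>k < length t. i + 1 = sum_list (take (k + 1) t) \<and> j < t ! k)"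
        using row by fastforce
      then show ?thesis using True ij mn
        by (auto simp: upper_shift_block_def lower_identity_block_def striped_companion_def R_def)
    next
      case False
      show ?thesis
      proof (cases "j < m + 1")
        case True
        then show ?thesis using False ij mn
          by (simp add: upper_shift_block_def lower_identity_block_def R_def)
      next
        case False2: False
        then have "\<not> (\<exists>k < length t. i + 1 = sum_list (take (k + 1) t) \<and> j < t ! k)"
          using col by fastforce
        then show ?thesis using False False2 ij mn
          by (auto simp: upper_shift_block_def lower_identity_block_def striped_companion_def R_def)
      qed
    qed
  qed (use mn in \<open>auto simp: upper_shift_block_def lower_identity_block_def striped_companion_def\<close>)
qed

end

theory Submission
  imports Defs "Jordan_Normal_Form.DL_Rank_Submatrix"
begin

text \<open>
  Put \<open>N = n + (\<Sum>k=1..<n. c\<^sub>k\<^sup>2)\<close>. Since \<open>c\<^sub>0 = 1\<close>, the factor \<open>F\<^sub>0\<close> is a diagonal sign matrix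
  that commutes with all other factors but \<open>F\<^sub>1\<close>, so it can be moved to one end of the product, where
  it does not affect the Frobenius norm. Of the other factors, the one of largest index can also be
  moved to an end, where it contributes \<open>c\<^sub>k\<^sup>2\<close> to the squared norm. Hence \<open>\<parallel>F\<parallel>\<^sup>2 = N\<close>, and the same argument
  applied to the inverse factors, which have the same shape up to reversing the order of the basis,
  gives \<open>\<parallel>F\<^sup>-\<^sup>1\<parallel>\<^sup>2 = N\<close>, so \<open>\<kappa>(F) = N\<close>.

  For \<open>S\<close> the rank condition yields \<open>S = shift - u b\<^sup>T\<close> with \<open>u\<close> the first column and \<open>b\<close> the last row of
  \<open>S\<close>. The inverse is then a shift whose new first row and last column consist of entries of \<open>b\<close> and
  \<open>u\<close>. So \<open>\<parallel>S\<^sup>-\<^sup>1\<parallel> \<le> \<parallel>S\<parallel>\<close>, and \<open>\<kappa>(S) \<le> \<parallel>S\<parallel>\<^sup>2 = N\<close>.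
\<close>

section \<open>Frobenius norm and condition number\<close>

lemma frobenius_norm_nonneg: "0 \<le> frobenius_norm A"
  by (simp add: frobenius_norm_def sum_nonneg)

lemma frobenius_norm_sq:
  assumes "A \<in> carrier_mat n m"
  shows "(frobenius_norm A)\<^sup>2 = (\<Sum>i<n. \<Sum>j<m. (A $$ (i, j))\<^sup>2)"
  using assms by (auto simp: frobenius_norm_def sum_nonneg)

lemma frobenius_norm_transpose: "frobenius_norm (transpose_mat A) = frobenius_norm A"
proof -
  have "(\<Sum>i<dim_col A. \<Sum>j<dim_row A. (transpose_mat A $$ (i, j))\<^sup>2)
      = (\<Sum>i<dim_col A. \<Sum>j<dim_row A. (A $$ (j, i))\<^sup>2)"
    by (intro sum.cong refl) auto
  also have "\<dots> = (\<Sum>j<dim_row A. \<Sum>i<dim_col A. (A $$ (j, i))\<^sup>2)"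
    by (rule sum.swap)
  finally show ?thesis by (simp add: frobenius_norm_def)
qed

text \<open>For square matrices a right inverse is two-sided and unique. Condition numbers can
  therefore be computed from any explicitly given right inverse.\<close>

lemma mat_inverse_eqI:
  fixes A :: "real mat"
  assumes "A \<in> carrier_mat n n" "B \<in> carrier_mat n n" "A * B = 1\<^sub>m n"
  shows "mat_inverse A = Some B"
proof (cases "mat_inverse A")
  case None
  have "B * A = 1\<^sub>m n" using assms mat_mult_left_right_inverse by blast
  then have "A \<in> Units (ring_mat TYPE(real) n ())"
    using assms by (auto simp: Units_def ring_mat_def)
  with mat_inverse(1)[OF assms(1) None, where b = "()"] show ?thesis by blast
next
  case (Some C)
  from mat_inverse(2)[OF assms(1) Some]
  have C: "C * A = 1\<^sub>m n" "C \<in> carrier_mat n n" by auto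
  have "C = C * (A * B)" using C assms by simp
  also have "\<dots> = (C * A) * B" by (rule assoc_mult_mat[OF C(2) assms(1,2), symmetric])
  also have "\<dots> = B" using C assms by simp
  finally show ?thesis using Some by simp
qed

lemma cond_number_eqI:
  assumes "A \<in> carrier_mat n n" "B \<in> carrier_mat n n" "A * B = 1\<^sub>m n"
  shows "cond_number A = frobenius_norm A * frobenius_norm B"
  using mat_inverse_eqI[OF assms] by (simp add: cond_number_def)

section \<open>Permutation similarity and transposition\<close>

lemma permutation_matrix_carrier[simp]: "permutation_matrix n \<pi> \<in> carrier_mat n n"
  by (simp add: permutation_matrix_def)

text \<open>Conjugation only renames rows and columns. Both the invariance of the norm and, with
  \<open>A\<close> the identity, the orthogonality of permutation matrices are read off from this
  entrywise form.\<close>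

lemma permutation_conjugate:
  assumes A: "A \<in> carrier_mat n n" and \<pi>: "\<pi> permutes {..<n}"
  shows "permutation_matrix n \<pi> * A * transpose_mat (permutation_matrix n \<pi>)
    = mat n n (\<lambda>(i, j). A $$ (\<pi> i, \<pi> j))"
proof (rule eq_matI, goal_cases)
  case (1 i j)
  then have ij: "i < n" "j < n" by simp_all
  then have p: "\<pi> i < n" "\<pi> j < n" using permutes_in_image[OF \<pi>] by auto
  have 1: "(permutation_matrix n \<pi> * A) $$ (i, k) = A $$ (\<pi> i, k)" if "k < n" for k
  proof -
    have "(\<Sum>l\<in>{0..<n}. (if \<pi> i = l then 1 else 0) * A $$ (l, k))
        = (\<Sum>l\<in>{0..<n}. if \<pi> i = l then A $$ (l, k) else 0)"
      by (rule sum.cong) auto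
    then show ?thesis using that ij p A
      by (simp add: scalar_prod_def row_def permutation_matrix_def)
  qed
  have "(\<Sum>k\<in>{0..<n}. A $$ (\<pi> i, k) * (if \<pi> j = k then 1 else 0))
        = (\<Sum>k\<in>{0..<n}. if \<pi> j = k then A $$ (\<pi> i, k) else 0)"
    by (rule sum.cong) auto
  then show ?case
    using ij p A 1 index_mult_mat(1)[of i "permutation_matrix n \<pi> * A" j]
    by (simp add: scalar_prod_def row_def[of "_ * _"] permutation_matrix_def
        del: index_mult_mat(1))
qed (use A in \<open>auto simp: permutation_matrix_def\<close>)

lemma frobenius_norm_permutation_conjugate:
  assumes A: "A \<in> carrier_mat n n" and \<pi>: "\<pi> permutes {..<n}"
  shows "frobenius_norm (permutation_matrix n \<pi> * A * transpose_mat (permutation_matrix n \<pi>))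
    = frobenius_norm A"
proof -
  have "(\<Sum>i<n. \<Sum>j<n. (A $$ (\<pi> i, \<pi> j))\<^sup>2) = (\<Sum>i<n. \<Sum>j<n. (A $$ (\<pi> i, j))\<^sup>2)"
    by (intro sum.cong refl sum.permute[OF \<pi>, unfolded comp_def, symmetric])
  also have "\<dots> = (\<Sum>i<n. \<Sum>j<n. (A $$ (i, j))\<^sup>2)"
    by (rule sum.permute[OF \<pi>, unfolded comp_def, symmetric])
  finally show ?thesis
    unfolding permutation_conjugate[OF assms] using A by (auto simp: frobenius_norm_def)
qed

lemma permutation_matrix_orthogonal:
  assumes \<pi>: "\<pi> permutes {..<n}"
  shows "permutation_matrix n \<pi> * transpose_mat (permutation_matrix n \<pi>) = 1\<^sub>m n"
proof -
  have "permutation_matrix n \<pi> * 1\<^sub>m n * transpose_mat (permutation_matrix n \<pi>)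
      = mat n n (\<lambda>(i, j). 1\<^sub>m n $$ (\<pi> i, \<pi> j))"
    by (rule permutation_conjugate[OF _ \<pi>]) simp
  also have "\<dots> = 1\<^sub>m n"
  proof (rule eq_matI, goal_cases)
    case (1 i j)
    then have ij: "i < n" "j < n" by simp_all
    then have "\<pi> i < n" "\<pi> j < n" using permutes_in_image[OF \<pi>] by auto
    moreover have "\<pi> i = \<pi> j \<longleftrightarrow> i = j" using permutes_inj[OF \<pi>] by (auto dest: injD)
    ultimately show ?case using ij by simp
  qed simp_all
  finally show ?thesis by (simp add: right_mult_one_mat[OF permutation_matrix_carrier])
qed

text \<open>The inverse of \<open>P * A * transpose_mat P\<close> is
  \<open>P * C * transpose_mat P\<close>, and conjugation preserves the norms of both
  \<open>A\<close> and \<open>C\<close>.\<close>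

lemma cond_number_permutation_similar:
  assumes sim: "permutation_similar A B"
    and A: "A \<in> carrier_mat n n" and C: "C \<in> carrier_mat n n" and AC: "A * C = 1\<^sub>m n"
  shows "cond_number B = frobenius_norm A * frobenius_norm C"
proof -
  obtain \<pi> where \<pi>: "\<pi> permutes {..<n}"
    and B: "B = permutation_matrix n \<pi> * A * transpose_mat (permutation_matrix n \<pi>)"
    using sim A unfolding permutation_similar_def by (metis carrier_matD(1))
  define P where "P = permutation_matrix n \<pi>"
  have P: "P \<in> carrier_mat n n" "transpose_mat P \<in> carrier_mat n n"
    by (simp_all add: P_def)
  have PP: "P * transpose_mat P = 1\<^sub>m n" "transpose_mat P * P = 1\<^sub>m n"
    using permutation_matrix_orthogonal[OF \<pi>] P mat_mult_left_right_inverse[of P n "transpose_mat P"]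
    by (auto simp: P_def)
  let ?D = "P * C * transpose_mat P"
  have "B * ?D = P * A * ((transpose_mat P * P) * (C * transpose_mat P))"
    unfolding B P_def[symmetric] using P A C by (simp add: assoc_mult_mat[of _ n n _ n _ n])
  also have "\<dots> = P * ((A * C) * transpose_mat P)"
    unfolding PP using P A C by (simp add: assoc_mult_mat[of _ n n _ n _ n])
  also have "\<dots> = 1\<^sub>m n" unfolding AC using P PP by simp
  finally have "B * ?D = 1\<^sub>m n" .
  moreover have "B \<in> carrier_mat n n" "?D \<in> carrier_mat n n"
    unfolding B P_def[symmetric] using P A C by auto
  ultimately show ?thesis
    using cond_number_eqI frobenius_norm_permutation_conjugate[OF _ \<pi>] A C
    unfolding B P_def by metis
qed

lemma cond_number_equivalent:
  assumes "equivalent_mat A B"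
    and A: "A \<in> carrier_mat n n" and C: "C \<in> carrier_mat n n" and AC: "A * C = 1\<^sub>m n"
  shows "cond_number B = frobenius_norm A * frobenius_norm C"
  using assms(1) unfolding equivalent_mat_def
proof
  assume "permutation_similar (transpose_mat A) B"
  moreover have "transpose_mat A * transpose_mat C = 1\<^sub>m n"
    using mat_mult_left_right_inverse[OF A C AC] transpose_mult[OF C A] by simp
  ultimately show ?thesis
    using cond_number_permutation_similar[of "transpose_mat A" B n "transpose_mat C"] A C
    by (simp add: frobenius_norm_transpose)
qed (use cond_number_permutation_similar assms in blast)

section \<open>Vanishing 2x2 minors of matrices of rank at most one\<close>

lemma det_two_by_two:
  fixes B :: "real mat"
  assumes "B \<in> carrier_mat 2 2"
  shows "det B = B $$ (0, 0) * B $$ (1, 1) - B $$ (0, 1) * B $$ (1, 0)"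
  using assms laplace_expansion_column[of B 2 0]
  by (simp add: numeral_2_eq_2 cofactor_def mat_delete_def det_single lessThan_Suc)

text \<open>A nonzero 2x2 minor would force the rank to be at least 2. The indices are ordered
  because \<open>submatrix\<close> lists the selected rows and columns increasingly.\<close>

lemma rank_1_minor:
  fixes A :: "real mat"
  assumes A: "A \<in> carrier_mat n nc" and rank: "vec_space.rank n A \<le> 1"
    and ik: "i < k" "k < n" and jl: "j < l" "l < nc"
  shows "A $$ (i, j) * A $$ (k, l) = A $$ (i, l) * A $$ (k, j)"
proof -
  let ?B = "submatrix A {i, k} {j, l}"
  have card: "card {a. a < n \<and> a \<in> {i, k}} = 2" "card {a. a < nc \<and> a \<in> {j, l}} = 2"
  proof -
    have "{a. a < n \<and> a \<in> {i, k}} = {i, k}" "{a. a < nc \<and> a \<in> {j, l}} = {j, l}"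
      using ik jl by auto
    then show "card {a. a < n \<and> a \<in> {i, k}} = 2" "card {a. a < nc \<and> a \<in> {j, l}} = 2"
      using ik jl by auto
  qed
  then have B: "?B \<in> carrier_mat 2 2" using A by (intro carrier_matI) (simp_all add: dim_submatrix)
  \<comment> \<open>\<open>submatrix_index_card\<close> locates an original entry by the number of
    selected indices below it, so the positions 0 and 1 appear as cardinalities.\<close>
  have "{a \<in> {i, k}. a < i} = {}" "{a \<in> {i, k}. a < k} = {i}"
       "{a \<in> {j, l}. a < j} = {}" "{a \<in> {j, l}. a < l} = {j}"
    using ik jl by auto
  then have c: "card {a \<in> {i, k}. a < i} = 0" "card {a \<in> {i, k}. a < k} = 1"
       "card {a \<in> {j, l}. a < j} = 0" "card {a \<in> {j, l}. a < l} = 1" by simp_all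
  have e: "?B $$ (0, 0) = A $$ (i, j)" "?B $$ (0, 1) = A $$ (i, l)"
       "?B $$ (1, 0) = A $$ (k, j)" "?B $$ (1, 1) = A $$ (k, l)"
    using submatrix_index_card[of i A j "{i, k}" "{j, l}"]
      submatrix_index_card[of i A l "{i, k}" "{j, l}"]
      submatrix_index_card[of k A j "{i, k}" "{j, l}"]
      submatrix_index_card[of k A l "{i, k}" "{j, l}"] ik jl A
    unfolding c by auto
  have "det ?B = 0"
    using vec_space.rank_gt_minor[OF A, of "{i, k}" "{j, l}"] rank card by fastforce
  moreover have "det ?B = ?B $$ (0, 0) * ?B $$ (1, 1) - ?B $$ (0, 1) * ?B $$ (1, 0)"
    using B by (rule det_two_by_two)
  ultimately show ?thesis unfolding e by simp
qed

section \<open>Products of elementary blocks\<close>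

definition mat_prod :: "nat \<Rightarrow> real mat list \<Rightarrow> real mat" where
  "mat_prod n Ms = foldr (*) Ms (1\<^sub>m n)"

lemma mat_prod_simps[simp]:
  "mat_prod n [] = 1\<^sub>m n" "mat_prod n (M # Ms) = M * mat_prod n Ms"
  by (simp_all add: mat_prod_def)

lemma mat_prod_carrier[simp]:
  "set Ms \<subseteq> carrier_mat n n \<Longrightarrow> mat_prod n Ms \<in> carrier_mat n n"
  by (induction Ms) (auto intro: mult_carrier_mat)

lemma mat_prod_append:
  assumes "set Ms \<subseteq> carrier_mat n n" "set Ns \<subseteq> carrier_mat n n"
  shows "mat_prod n (Ms @ Ns) = mat_prod n Ms * mat_prod n Ns"
  using assms(1)
proof (induction Ms)
  case Nil
  then show ?case using assms(2) by (simp add: left_mult_one_mat[OF mat_prod_carrier])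
next
  case (Cons M Ms)
  then show ?case using assms(2)
    by (simp add: assoc_mult_mat[of M n n "mat_prod n Ms" n "mat_prod n Ns" n])
qed

lemma mat_prod_commute:
  assumes "set Ms \<subseteq> carrier_mat n n" "A \<in> carrier_mat n n" "\<And>M. M \<in> set Ms \<Longrightarrow> A * M = M * A"
  shows "A * mat_prod n Ms = mat_prod n Ms * A"
  using assms(1,3)
proof (induction Ms)
  case Nil
  then show ?case using assms(2) by simp
next
  case (Cons M Ms)
  have M: "M \<in> carrier_mat n n" and P: "mat_prod n Ms \<in> carrier_mat n n"
    using Cons.prems by auto
  have "A * (M * mat_prod n Ms) = (A * M) * mat_prod n Ms"
    by (rule assoc_mult_mat[OF assms(2) M P, symmetric])
  also have "\<dots> = (M * A) * mat_prod n Ms" using Cons.prems by simp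
  also have "\<dots> = M * (A * mat_prod n Ms)" by (rule assoc_mult_mat[OF M assms(2) P])
  also have "\<dots> = M * (mat_prod n Ms * A)" using Cons by simp
  also have "\<dots> = (M * mat_prod n Ms) * A" by (rule assoc_mult_mat[OF M P assms(2), symmetric])
  finally show ?case by simp
qed

text \<open>The side on which \<open>A\<close> ends up is left open: the norm results used
  afterwards exist for multiplication from the left and from the right.\<close>

lemma mat_prod_extract:
  assumes Ms: "set Ms \<subseteq> carrier_mat n n" and Ns: "set Ns \<subseteq> carrier_mat n n"
    and A: "A \<in> carrier_mat n n"
    and comm: "(\<forall>M \<in> set Ms. A * M = M * A) \<or> (\<forall>M \<in> set Ns. A * M = M * A)"
  shows "mat_prod n (Ms @ A # Ns) = A * mat_prod n (Ms @ Ns) \<or>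
         mat_prod n (Ms @ A # Ns) = mat_prod n (Ms @ Ns) * A"
proof -
  let ?P = "mat_prod n Ms" and ?Q = "mat_prod n Ns"
  have P: "?P \<in> carrier_mat n n" and Q: "?Q \<in> carrier_mat n n"
    using Ms Ns by auto
  have eq: "mat_prod n (Ms @ A # Ns) = ?P * (A * ?Q)" "mat_prod n (Ms @ Ns) = ?P * ?Q"
    using assms by (simp_all add: mat_prod_append)
  from comm show ?thesis
  proof
    assume "\<forall>M \<in> set Ms. A * M = M * A"
    then have "A * ?P = ?P * A" using mat_prod_commute[OF Ms A] by blast
    then have "?P * (A * ?Q) = A * (?P * ?Q)"
      by (metis assoc_mult_mat[OF P A Q] assoc_mult_mat[OF A P Q])
    then show ?thesis unfolding eq by blast
  next
    assume "\<forall>M \<in> set Ns. A * M = M * A"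
    then have "A * ?Q = ?Q * A" using mat_prod_commute[OF Ns A] by blast
    then have "?P * (A * ?Q) = ?P * ?Q * A"
      by (metis assoc_mult_mat[OF P Q A])
    then show ?thesis unfolding eq by blast
  qed
qed

text \<open>The product of the \<open>Y k\<close> is taken in reverse order, so the pairs
  \<open>X k * Y k\<close> cancel from the middle outwards.\<close>

lemma mat_prod_inverse:
  assumes "\<And>k. k \<in> set ks \<Longrightarrow> X k \<in> carrier_mat n n"
    and "\<And>k. k \<in> set ks \<Longrightarrow> Y k \<in> carrier_mat n n"
    and "\<And>k. k \<in> set ks \<Longrightarrow> X k * Y k = 1\<^sub>m n"
  shows "mat_prod n (map X ks) * mat_prod n (rev (map Y ks)) = 1\<^sub>m n"
  using assms
proof (induction ks)
  case (Cons k ks)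
  define P Q where "P = mat_prod n (map X ks)" and "Q = mat_prod n (rev (map Y ks))"
  have PQ: "P \<in> carrier_mat n n" "Q \<in> carrier_mat n n" "P * Q = 1\<^sub>m n"
    using Cons unfolding P_def Q_def by (auto intro!: mat_prod_carrier)
  have XY: "X k \<in> carrier_mat n n" "Y k \<in> carrier_mat n n" "X k * Y k = 1\<^sub>m n"
    using Cons.prems by auto
  have "mat_prod n (rev (map Y (k # ks))) = Q * Y k"
    using Cons.prems(2) XY unfolding Q_def by (auto simp: mat_prod_append image_subset_iff right_mult_one_mat[OF XY(2)])
  then have "mat_prod n (map X (k # ks)) * mat_prod n (rev (map Y (k # ks))) = (X k * P) * (Q * Y k)"
    by (simp add: P_def)
  also have "\<dots> = X k * (P * Q * Y k)"
    using PQ(1,2) XY(1,2) by (simp add: assoc_mult_mat[of _ n n _ n _ n])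
  also have "\<dots> = 1\<^sub>m n" using PQ XY by simp
  finally show ?case .
qed simp

text \<open>The block [[a, 1], [1, 0]] on the ordered pair of positions \<open>i\<close>,
  \<open>j\<close>, the identity elsewhere. Not tying the pair to increasing neighbours lets the
  inverse have the same shape: exchange \<open>i\<close> and \<open>j\<close> and negate
  \<open>a\<close>.\<close>

definition swap_block :: "nat \<Rightarrow> nat \<Rightarrow> nat \<Rightarrow> real \<Rightarrow> real mat" where
  "swap_block n i j a = mat n n (\<lambda>(r, c).
     if r = i then (if c = i then a else if c = j then 1 else 0)
     else if r = j then (if c = i then 1 else 0)
     else (if r = c then 1 else 0))"

lemma swap_block_carrier[simp]: "swap_block n i j a \<in> carrier_mat n n"
  by (simp add: swap_block_def)

lemma transpose_swap_block: "transpose_mat (swap_block n i j a) = swap_block n i j a"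
  by (rule eq_matI) (auto simp: swap_block_def)

lemma swap_block_mult:
  assumes P: "P \<in> carrier_mat n n" and ij: "i < n" "j < n" "i \<noteq> j" and rc: "r < n" "c < n"
  shows "(swap_block n i j a * P) $$ (r, c) =
    (if r = i then a * P $$ (i, c) + P $$ (j, c) else if r = j then P $$ (i, c) else P $$ (r, c))"
proof -
  have "(swap_block n i j a * P) $$ (r, c) = (\<Sum>k\<in>{0..<n}. swap_block n i j a $$ (r, k) * P $$ (k, c))"
    using P rc by (simp add: scalar_prod_def swap_block_def)
  \<comment> \<open>Row \<open>r\<close> of the block is split into indicators of the columns
    \<open>i\<close>, \<open>j\<close> and \<open>r\<close>, the last one serving the rows that the
    block leaves alone.\<close>
  also have "\<dots> = (\<Sum>k\<in>{0..<n}.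
      (if k = i then (if r = i then a else if r = j then 1 else 0) * P $$ (k, c) else 0) +
      (if k = j then (if r = i then 1 else 0) * P $$ (k, c) else 0) +
      (if k = r then (if r \<noteq> i \<and> r \<noteq> j then 1 else 0) * P $$ (k, c) else 0))"
    using ij rc by (intro sum.cong) (auto simp: swap_block_def)
  also have "\<dots> = (if r = i then a * P $$ (i, c) + P $$ (j, c) else if r = j then P $$ (i, c) else P $$ (r, c))"
    using ij rc by (simp add: sum.distrib)
  finally show ?thesis .
qed

lemma swap_block_commute:
  assumes "i < n" "j < n" "i \<noteq> j" "k < n" "l < n" "k \<noteq> l" "{i, j} \<inter> {k, l} = {}"
  shows "swap_block n i j a * swap_block n k l b = swap_block n k l b * swap_block n i j a"
proof (rule eq_matI, goal_cases)
  case (1 r c)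
  then have rc: "r < n" "c < n" by (simp_all add: swap_block_def)
  show ?case
    unfolding swap_block_mult[OF swap_block_carrier assms(1-3) rc]
      swap_block_mult[OF swap_block_carrier assms(4-6) rc]
    using rc assms by (auto simp: swap_block_def)
qed (simp_all add: swap_block_def)

lemma swap_block_inverse:
  assumes "i < n" "j < n" "i \<noteq> j"
  shows "swap_block n i j a * swap_block n j i (- a) = 1\<^sub>m n"
proof (rule eq_matI, goal_cases)
  case (1 r c)
  then have rc: "r < n" "c < n" by simp_all
  show ?case
    unfolding swap_block_mult[OF swap_block_carrier assms rc]
    using rc assms by (auto simp: swap_block_def)
qed (simp_all add: swap_block_def)

text \<open>Row \<open>j\<close> of the product is the old unit row \<open>i\<close>, and row
  \<open>i\<close> is the old row \<open>j\<close> plus \<open>a\<close> times that unit row. As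
  column \<open>i\<close> of \<open>P\<close> is also a unit vector, \<open>a\<close> falls on a
  zero entry, so squaring gives no cross term.\<close>

lemma frobenius_norm_swap_block_mult:
  assumes P: "P \<in> carrier_mat n n" and ij: "i < n" "j < n" "i \<noteq> j"
    and unit: "\<And>k. k < n \<Longrightarrow> P $$ (i, k) = (if k = i then 1 else 0)"
              "\<And>k. k < n \<Longrightarrow> P $$ (k, i) = (if k = i then 1 else 0)"
  shows "(frobenius_norm (swap_block n i j a * P))\<^sup>2 = (frobenius_norm P)\<^sup>2 + a\<^sup>2"
proof -
  let ?Q = "swap_block n i j a * P"
  define g where "g A r = (\<Sum>c<n. (A $$ (r, c))\<^sup>2)" for A :: "real mat" and r
  have split: "(\<Sum>r<n. g A r) = g A i + g A j + (\<Sum>r\<in>{..<n} - {i, j}. g A r)" for A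
  proof -
    have "(\<Sum>r<n. g A r) = (\<Sum>r\<in>{..<n} - {i, j}. g A r) + (\<Sum>r\<in>{i, j}. g A r)"
      using ij by (intro sum.subset_diff) auto
    then show ?thesis using ij by simp
  qed
  have "g ?Q i = (\<Sum>c<n. (if c = i then a\<^sup>2 else 0) + (P $$ (j, c))\<^sup>2)"
    unfolding g_def
  proof (rule sum.cong)
    fix c assume "c \<in> {..<n}"
    then show "(?Q $$ (i, c))\<^sup>2 = (if c = i then a\<^sup>2 else 0) + (P $$ (j, c))\<^sup>2"
      using swap_block_mult[OF P ij ij(1), of c a] unit ij by simp
  qed simp
  then have i: "g ?Q i = a\<^sup>2 + g P j" using ij by (simp add: sum.distrib g_def)
  have j: "g ?Q j = g P i" unfolding g_def
    using swap_block_mult[OF P ij ij(2), of _ a] ij by (intro sum.cong) auto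
  have "g ?Q r = g P r" if "r \<in> {..<n} - {i, j}" for r
    unfolding g_def using that swap_block_mult[OF P ij, of r _ a] by (intro sum.cong) auto
  then have "(\<Sum>r\<in>{..<n} - {i, j}. g ?Q r) = (\<Sum>r\<in>{..<n} - {i, j}. g P r)"
    by (rule sum.cong[OF refl])
  with split[of ?Q] split[of P] i j have "(\<Sum>r<n. g ?Q r) = (\<Sum>r<n. g P r) + a\<^sup>2" by simp
  moreover have "?Q \<in> carrier_mat n n" using P by (meson mult_carrier_mat swap_block_carrier)
  ultimately show ?thesis
    using frobenius_norm_sq[of ?Q n n] frobenius_norm_sq[OF P] by (simp add: g_def)
qed

lemma frobenius_norm_mult_swap_block:
  assumes P: "P \<in> carrier_mat n n" and ij: "i < n" "j < n" "i \<noteq> j"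
    and unit: "\<And>k. k < n \<Longrightarrow> P $$ (i, k) = (if k = i then 1 else 0)"
              "\<And>k. k < n \<Longrightarrow> P $$ (k, i) = (if k = i then 1 else 0)"
  shows "(frobenius_norm (P * swap_block n i j a))\<^sup>2 = (frobenius_norm P)\<^sup>2 + a\<^sup>2"
proof -
  have "transpose_mat (P * swap_block n i j a) = swap_block n i j a * transpose_mat P"
    using P transpose_mult[OF P swap_block_carrier] by (simp add: transpose_swap_block)
  then have "frobenius_norm (P * swap_block n i j a) = frobenius_norm (swap_block n i j a * transpose_mat P)"
    using frobenius_norm_transpose by metis
  then show ?thesis
    using frobenius_norm_swap_block_mult[of "transpose_mat P" n i j a] assms
    by (simp add: frobenius_norm_transpose)
qed

text \<open>Blocks that avoid position \<open>i\<close> all have unit vectors as row and column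
  \<open>i\<close>, and so does their product. This supplies the \<open>unit\<close> hypotheses of
  the two norm lemmas above.\<close>

lemma swap_block_prod_unit:
  assumes "\<And>k. k \<in> set ks \<Longrightarrow> x k < n \<and> y k < n \<and> x k \<noteq> y k \<and> i \<noteq> x k \<and> i \<noteq> y k"
    and "i < n" "r < n"
  shows "mat_prod n (map (\<lambda>k. swap_block n (x k) (y k) (a k)) ks) $$ (i, r) = (if r = i then 1 else 0)"
    and "mat_prod n (map (\<lambda>k. swap_block n (x k) (y k) (a k)) ks) $$ (r, i) = (if r = i then 1 else 0)"
proof -
  let ?P = "\<lambda>ks. mat_prod n (map (\<lambda>k. swap_block n (x k) (y k) (a k)) ks)"
  have "\<forall>r<n. ?P ks $$ (i, r) = (if r = i then 1 else 0) \<and> ?P ks $$ (r, i) = (if r = i then 1 else 0)"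
    using assms(1)
  proof (induction ks)
    case Nil
    then show ?case using assms by auto
  next
    case (Cons k ks)
    have P: "?P ks \<in> carrier_mat n n" by (rule mat_prod_carrier) auto
    have k: "x k < n" "y k < n" "x k \<noteq> y k" "i \<noteq> x k" "i \<noteq> y k" using Cons.prems by auto
    have "\<forall>r<n. ?P ks $$ (i, r) = (if r = i then 1 else 0) \<and> ?P ks $$ (r, i) = (if r = i then 1 else 0)"
      using Cons by simp
    with swap_block_mult[OF P k(1-3)] k assms(2) show ?case by simp
  qed
  with assms(3) show "?P ks $$ (i, r) = (if r = i then 1 else 0)"
    "?P ks $$ (r, i) = (if r = i then 1 else 0)" by auto
qed

text \<open>The factor of largest index \<open>k\<close> fails to commute only with the one of index \<open>k - 1\<close>, so it can be
  moved to one end of the product, and the remaining factors fix the basis vector \<open>v k\<close>.\<close>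

lemma frobenius_norm_swap_block_chain:
  fixes ks :: "nat list"
  assumes v: "inj_on v {..<N}" "v ` {..<N} \<subseteq> {..<n}"
    and "distinct ks" "set ks \<subseteq> {1..<N}"
  shows "(frobenius_norm (mat_prod n (map (\<lambda>k. swap_block n (v k) (v (k - 1)) (a k)) ks)))\<^sup>2
    = real n + (\<Sum>k\<in>set ks. (a k)\<^sup>2)"
  using assms(3,4)
proof (induction "length ks" arbitrary: ks)
  case 0
  then show ?case
    by (simp add: frobenius_norm_sq[of _ n n] if_distrib[of "\<lambda>x. x\<^sup>2"] cong: if_cong)
next
  case (Suc len)
  let ?X = "\<lambda>k. swap_block n (v k) (v (k - 1)) (a k)"
  define k where "k = Max (set ks)"
  have ne: "ks \<noteq> []" using Suc.hyps by auto
  then have "k \<in> set ks" unfolding k_def by (intro Max_in) auto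
  then obtain ys zs where ks: "ks = ys @ k # zs" by (meson split_list)
  have lt: "l < k" if "l \<in> set (ys @ zs)" for l
  proof -
    have "l \<in> set ks" using that by (subst ks) auto
    then have "l \<le> k" unfolding k_def by simp
    moreover have "l \<noteq> k" using that ks Suc.prems(1) by auto
    ultimately show ?thesis by simp
  qed
  have vlt: "v l < n" if "l < N" for l using v that by blast
  have veq: "v l = v m \<longleftrightarrow> l = m" if "l < N" "m < N" for l m
    using inj_on_eq_iff[OF v(1)] that by simp
  have kN: "1 \<le> k" "k < N" using Suc.prems(2) ks by auto
  have lN: "1 \<le> l \<and> l < k \<and> l < N" if "l \<in> set (ys @ zs)" for l
    using that Suc.prems(2) ks lt[OF that] by auto
  let ?P = "mat_prod n (map ?X (ys @ zs))"
  have P: "?P \<in> carrier_mat n n" by (rule mat_prod_carrier) auto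
  \<comment> \<open>Block \<open>l\<close> occupies \<open>v l\<close> and \<open>v (l - 1)\<close>.
    For \<open>l < k\<close> these can meet the positions of block \<open>k\<close> only if
    \<open>l = k - 1\<close>.\<close>
  have comm: "?X k * ?X l = ?X l * ?X k" if "l \<in> set (ys @ zs)" "l \<noteq> k - 1" for l
    using lN[OF that(1)] that kN by (intro swap_block_commute) (auto simp: vlt veq)
  have "(\<forall>M\<in>set (map ?X ys). ?X k * M = M * ?X k) \<or> (\<forall>M\<in>set (map ?X zs). ?X k * M = M * ?X k)"
  \<comment> \<open>Since the indices are distinct, \<open>k - 1\<close> is missing on at least one
    side of \<open>k\<close>, and block \<open>k\<close> can leave on that side.\<close>
  proof (cases "k - 1 \<in> set ys")
    case True
    then have "k - 1 \<notin> set zs" using Suc.prems(1) ks by auto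
    then have "\<forall>M\<in>set (map ?X zs). ?X k * M = M * ?X k" using comm by (auto simp del: One_nat_def)
    then show ?thesis by blast
  next
    case False
    then have "\<forall>M\<in>set (map ?X ys). ?X k * M = M * ?X k" using comm by (auto simp del: One_nat_def)
    then show ?thesis by blast
  qed
  then have "mat_prod n (map ?X ys @ ?X k # map ?X zs) = ?X k * mat_prod n (map ?X ys @ map ?X zs) \<or>
      mat_prod n (map ?X ys @ ?X k # map ?X zs) = mat_prod n (map ?X ys @ map ?X zs) * ?X k"
    by (intro mat_prod_extract) auto
  then have "mat_prod n (map ?X ks) = ?X k * ?P \<or> mat_prod n (map ?X ks) = ?P * ?X k"
    by (simp add: ks)
  moreover have "?P $$ (v k, r) = (if r = v k then 1 else 0)"
    "?P $$ (r, v k) = (if r = v k then 1 else 0)" if "r < n" for r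
  proof -
    have "v l < n \<and> v (l - 1) < n \<and> v l \<noteq> v (l - 1) \<and> v k \<noteq> v l \<and> v k \<noteq> v (l - 1)"
      if "l \<in> set (ys @ zs)" for l
      using lN[OF that] kN by (auto simp: vlt veq)
    from swap_block_prod_unit[of "ys @ zs" v n "\<lambda>k. v (k - 1)" "v k" r, OF this vlt[OF kN(2)] that]
    show "?P $$ (v k, r) = (if r = v k then 1 else 0)"
      "?P $$ (r, v k) = (if r = v k then 1 else 0)" by blast+
  qed
  moreover have "v k < n" "v (k - 1) < n" "v k \<noteq> v (k - 1)" using kN by (auto simp: vlt veq)
  ultimately have "(frobenius_norm (mat_prod n (map ?X ks)))\<^sup>2 = (frobenius_norm ?P)\<^sup>2 + (a k)\<^sup>2"
    using frobenius_norm_swap_block_mult[OF P, of "v k" "v (k - 1)" "a k"]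
      frobenius_norm_mult_swap_block[OF P, of "v k" "v (k - 1)" "a k"] by (elim disjE) simp_all
  also have "(frobenius_norm ?P)\<^sup>2 = real n + (\<Sum>k\<in>set (ys @ zs). (a k)\<^sup>2)"
    using Suc.hyps(2) Suc.prems ks by (intro Suc.hyps(1)) auto
  finally have "(frobenius_norm (mat_prod n (map ?X ks)))\<^sup>2
      = real n + (\<Sum>k\<in>set (ys @ zs). (a k)\<^sup>2) + (a k)\<^sup>2" .
  moreover have "set ks = insert k (set (ys @ zs))" "k \<notin> set (ys @ zs)" using ks lt by auto
  ultimately show ?case by simp
qed

section \<open>Fiedler companion matrices\<close>

definition sign_matrix :: "nat \<Rightarrow> real mat" where
  "sign_matrix n = mat n n (\<lambda>(i, j). if i = j then if i = n - 1 then - 1 else 1 else 0)"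

lemma sign_matrix_carrier[simp]: "sign_matrix n \<in> carrier_mat n n"
  by (simp add: sign_matrix_def)

lemma transpose_sign_matrix: "transpose_mat (sign_matrix n) = sign_matrix n"
  by (rule eq_matI) (auto simp: sign_matrix_def)

lemma sign_matrix_mult:
  assumes P: "P \<in> carrier_mat n n" and rc: "r < n" "c < n"
  shows "(sign_matrix n * P) $$ (r, c) = (if r = n - 1 then - P $$ (r, c) else P $$ (r, c))"
proof -
  have "(sign_matrix n * P) $$ (r, c) = (\<Sum>k\<in>{0..<n}. sign_matrix n $$ (r, k) * P $$ (k, c))"
    using P rc by (simp add: scalar_prod_def sign_matrix_def)
  also have "\<dots> = (\<Sum>k\<in>{0..<n}. if k = r then (if r = n - 1 then - P $$ (k, c) else P $$ (k, c)) else 0)"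
    using rc by (intro sum.cong) (auto simp: sign_matrix_def)
  finally show ?thesis using rc by simp
qed

lemma sign_matrix_square: "sign_matrix n * sign_matrix n = 1\<^sub>m n"
proof (rule eq_matI, goal_cases)
  case (1 r c)
  then have rc: "r < n" "c < n" by simp_all
  show ?case unfolding sign_matrix_mult[OF sign_matrix_carrier rc] using rc
    by (auto simp: sign_matrix_def)
qed (simp_all add: sign_matrix_def)

lemma frobenius_norm_sign_matrix_mult:
  assumes P: "P \<in> carrier_mat n n"
  shows "frobenius_norm (sign_matrix n * P) = frobenius_norm P"
proof -
  have D: "sign_matrix n * P \<in> carrier_mat n n" using P by (meson mult_carrier_mat sign_matrix_carrier)
  have "(frobenius_norm (sign_matrix n * P))\<^sup>2 = (frobenius_norm P)\<^sup>2"
    unfolding frobenius_norm_sq[OF D] frobenius_norm_sq[OF P]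
    by (intro sum.cong refl) (simp add: sign_matrix_mult[OF P] del: index_mult_mat)
  then show ?thesis by (simp add: frobenius_norm_nonneg power2_eq_iff_nonneg)
qed

lemma frobenius_norm_mult_sign_matrix:
  assumes P: "P \<in> carrier_mat n n"
  shows "frobenius_norm (P * sign_matrix n) = frobenius_norm P"
  using frobenius_norm_sign_matrix_mult[of "transpose_mat P" n]
    frobenius_norm_transpose[of "P * sign_matrix n"] P
    transpose_mult[OF P sign_matrix_carrier]
  by (simp add: transpose_sign_matrix frobenius_norm_transpose)

text \<open>On the two positions of the block the sign matrix acts as the identity.\<close>

lemma sign_matrix_commute:
  assumes "i < n" "j < n" "i \<noteq> j" "i \<noteq> n - 1" "j \<noteq> n - 1"
  shows "sign_matrix n * swap_block n i j a = swap_block n i j a * sign_matrix n"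
proof (rule eq_matI, goal_cases)
  case (1 r c)
  then have rc: "r < n" "c < n" by (simp_all add: sign_matrix_def swap_block_def)
  show ?case
    unfolding swap_block_mult[OF sign_matrix_carrier assms(1-3) rc]
      sign_matrix_mult[OF swap_block_carrier rc]
    using rc assms by (auto simp: swap_block_def sign_matrix_def)
qed (simp_all add: sign_matrix_def swap_block_def)

lemma fiedler_factor_0:
  assumes "1 \<le> n" "coeff p 0 = 1"
  shows "fiedler_factor n p 0 = sign_matrix n"
  by (rule eq_matI) (use assms in \<open>auto simp: fiedler_factor_def sign_matrix_def mat_of_rows_list_def\<close>)

lemma fiedler_factor_pos:
  assumes "1 \<le> k" "k < n"
  shows "fiedler_factor n p k = swap_block n (n - k - 1) (n - k) (- coeff p k)"
proof (rule eq_matI, goal_cases)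
  case (1 i j)
  then have ij: "i < n" "j < n" by (simp_all add: swap_block_def)
  \<comment> \<open>With the diagonal block sizes named \<open>a\<close>, 2, \<open>b\<close>, the
    truncated subtractions disappear from the comparison of entries.\<close>
  obtain a b where ab: "n = a + 2 + b" "n - k - 1 = a" "n - k = Suc a" "k - 1 = b"
    using assms that[of "n - k - 1" "k - 1"] by force
  have "k \<noteq> 0" using assms by simp
  then have F: "fiedler_factor n p k =
      diag_block_mat [1\<^sub>m a, mat_of_rows_list 2 [[- coeff p k, 1], [1, 0]], 1\<^sub>m b]"
    unfolding fiedler_factor_def ab(2,4) by simp
  have "i < a \<or> i = a \<or> i = Suc a \<or> a + 2 \<le> i" "j < a \<or> j = a \<or> j = Suc a \<or> a + 2 \<le> j"
    by linarith+
  then show ?case using ij ab(1) unfolding F ab(2,3) swap_block_def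
    by (elim disjE) (auto simp: mat_of_rows_list_def)
qed (use assms in \<open>auto simp: fiedler_factor_def swap_block_def mat_of_rows_list_def\<close>)

lemma fiedler_product_norm:
  assumes n: "1 \<le> n" and p: "coeff p 0 = 1" and \<sigma>: "distinct \<sigma>" "set \<sigma> = {..<n}"
  defines "N \<equiv> real n + (\<Sum>k\<in>{1..<n}. (coeff p k)\<^sup>2)"
  shows "\<exists>G \<in> carrier_mat n n. fiedler_product n p \<sigma> \<in> carrier_mat n n \<and>
    fiedler_product n p \<sigma> * G = 1\<^sub>m n \<and>
    (frobenius_norm (fiedler_product n p \<sigma>))\<^sup>2 = N \<and> (frobenius_norm G)\<^sup>2 = N"
proof -
  have "0 \<in> set \<sigma>" using n \<sigma> by auto
  then obtain ys zs where s: "\<sigma> = ys @ 0 # zs" by (meson split_list)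
  define ks where "ks = ys @ zs"
  have "set ks = set \<sigma> - {0}" using \<sigma>(1) unfolding s ks_def by auto
  moreover have "{..<n} - {0} = {1..<n}"
  proof (rule Set.set_eqI)
    show "k \<in> {..<n} - {0} \<longleftrightarrow> k \<in> {1..<n}" for k by (cases k) simp_all
  qed
  ultimately have "set ks = {1..<n}" using \<sigma>(2) by metis
  moreover have "distinct ks" using \<sigma>(1) unfolding s ks_def by simp
  ultimately have ks: "distinct ks" "set ks = {1..<n}" by blast+
  define X where "X k = swap_block n (n - k - 1) (n - k) (- coeff p k)" for k
  define Y where "Y k = swap_block n (n - k) (n - k - 1) (coeff p k)" for k
  define Q where "Q = mat_prod n (map X ks)"
  define Q' where "Q' = mat_prod n (rev (map Y ks))"
  let ?D = "sign_matrix n"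
  have XY: "X k \<in> carrier_mat n n" "Y k \<in> carrier_mat n n" for k by (simp_all add: X_def Y_def)
  have Q: "Q \<in> carrier_mat n n" "Q' \<in> carrier_mat n n"
    unfolding Q_def Q'_def using XY by (auto intro!: mat_prod_carrier)
  have QQ: "Q * Q' = 1\<^sub>m n" unfolding Q_def Q'_def
  proof (rule mat_prod_inverse[OF XY])
    fix k assume "k \<in> set ks"
    then have "n - k - 1 < n" "n - k < n" "n - k - 1 \<noteq> n - k" unfolding ks(2) by auto
    from swap_block_inverse[OF this, of "- coeff p k"]
    show "X k * Y k = 1\<^sub>m n" by (simp add: X_def Y_def)
  qed
  have "fiedler_factor n p k = X k" if "k \<in> set ks" for k
    using that fiedler_factor_pos[of k n p] unfolding ks(2) X_def by simp
  then have ff: "map (fiedler_factor n p) ys = map X ys" "map (fiedler_factor n p) zs = map X zs"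
    unfolding ks_def by auto
  have "(\<forall>M\<in>set (map X ys). ?D * M = M * ?D) \<or> (\<forall>M\<in>set (map X zs). ?D * M = M * ?D)"
  proof -
    \<comment> \<open>The sign sits at position \<open>n - 1\<close>, which among all
      \<open>X k\<close> only \<open>X 1\<close> touches.\<close>
    have comm: "?D * X k = X k * ?D" if "k \<in> set ks" "k \<noteq> 1" for k
      unfolding X_def using that ks(2) by (intro sign_matrix_commute) auto
    show ?thesis
    proof (cases "1 \<in> set ys")
      case True
      then have "1 \<notin> set zs" using ks(1) unfolding ks_def by auto
      then have "\<forall>M\<in>set (map X zs). ?D * M = M * ?D"
        using comm unfolding ks_def by (auto simp del: One_nat_def)
      then show ?thesis by blast
    next
      case False
      then have "\<forall>M\<in>set (map X ys). ?D * M = M * ?D"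
        using comm unfolding ks_def by (auto simp del: One_nat_def)
      then show ?thesis by blast
    qed
  qed
  then have "mat_prod n (map X ys @ ?D # map X zs) = ?D * mat_prod n (map X ys @ map X zs) \<or>
      mat_prod n (map X ys @ ?D # map X zs) = mat_prod n (map X ys @ map X zs) * ?D"
    using XY by (intro mat_prod_extract) auto
  moreover have "fiedler_product n p \<sigma> = mat_prod n (map X ys @ ?D # map X zs)"
    unfolding fiedler_product_def mat_prod_def s map_append list.map ff fiedler_factor_0[OF n p]
    by (rule refl)
  ultimately have FP: "fiedler_product n p \<sigma> = ?D * Q \<or> fiedler_product n p \<sigma> = Q * ?D"
    by (simp add: Q_def ks_def)
  have norm_Q: "(frobenius_norm Q)\<^sup>2 = N"
  proof -
    \<comment> \<open>The Fiedler factors form a chain along the reversed basis: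
      \<open>v (k - 1) = n - k\<close> for \<open>k\<close> from 1 to \<open>n - 1\<close>.\<close>
    define v where "v k = n - k - 1" for k
    have Xs: "map X ks = map (\<lambda>k. swap_block n (v k) (v (k - 1)) (- coeff p k)) ks"
      using ks(2) by (auto simp: X_def v_def)
    have "inj_on v {..<n}" "v ` {..<n} \<subseteq> {..<n}"
      by (auto simp: v_def inj_on_def)
    then show ?thesis
      using frobenius_norm_swap_block_chain[of v n n ks "\<lambda>k. - coeff p k"] ks
      unfolding Q_def N_def Xs by simp
  qed
  have norm_Q': "(frobenius_norm Q')\<^sup>2 = N"
  proof -
    \<comment> \<open>\<open>Y k\<close> has the pair \<open>n - k\<close>,
      \<open>n - k - 1\<close>, so it is the chain block of index \<open>n - k\<close> along the
      unreversed basis. The list is reversed because inversion reverses the product.\<close>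
    define ls where "ls = map (\<lambda>k. n - k) (rev ks)"
    have Ys: "rev (map Y ks) = map (\<lambda>k. swap_block n (id k) (id (k - 1)) (coeff p (n - k))) ls"
      using ks(2) by (auto simp: rev_map ls_def Y_def)
    have "set ls = (\<lambda>k. n - k) ` {1..<n}" by (simp add: ls_def ks)
    also have "\<dots> = {1..<n}"
    proof (rule Set.set_eqI)
      show "k \<in> (\<lambda>k. n - k) ` {1..<n} \<longleftrightarrow> k \<in> {1..<n}" for k
        by (auto intro!: image_eqI[of k _ "n - k"])
    qed
    finally have "set ls = {1..<n}" .
    moreover have "distinct ls" using ks unfolding ls_def
      by (auto simp: distinct_map inj_on_def)
    ultimately have "(frobenius_norm Q')\<^sup>2 = real n + (\<Sum>k\<in>{1..<n}. (coeff p (n - k))\<^sup>2)"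
      using frobenius_norm_swap_block_chain[of id n n ls "\<lambda>k. coeff p (n - k)"]
      unfolding Q'_def Ys by simp
    also have "(\<Sum>k\<in>{1..<n}. (coeff p (n - k))\<^sup>2) = (\<Sum>k\<in>{1..<n}. (coeff p k)\<^sup>2)"
      by (rule sum.reindex_bij_witness[of _ "\<lambda>k. n - k" "\<lambda>k. n - k"]) auto
    finally show ?thesis by (simp add: N_def)
  qed
  note [simp] = frobenius_norm_sign_matrix_mult frobenius_norm_mult_sign_matrix
  have D: "?D \<in> carrier_mat n n" by simp
  from FP show ?thesis
  proof
    assume F: "fiedler_product n p \<sigma> = ?D * Q"
    have "?D * Q * (Q' * ?D) = ?D * (Q * Q' * ?D)"
      using Q D by (simp add: assoc_mult_mat[of _ n n _ n _ n])
    also have "\<dots> = 1\<^sub>m n" unfolding QQ left_mult_one_mat[OF D] by (rule sign_matrix_square)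
    finally show ?thesis unfolding F using Q D norm_Q norm_Q'
      by (intro bexI[of _ "Q' * ?D"] conjI mult_carrier_mat[of _ n n _ n]) auto
  next
    assume F: "fiedler_product n p \<sigma> = Q * ?D"
    have "Q * ?D * (?D * Q') = Q * (?D * ?D * Q')"
      using Q D mult_carrier_mat[OF D Q(2)] by (simp add: assoc_mult_mat[of _ n n _ n _ n])
    also have "\<dots> = 1\<^sub>m n" unfolding sign_matrix_square left_mult_one_mat[OF Q(2)] by (rule QQ)
    finally show ?thesis unfolding F using Q D norm_Q norm_Q'
      by (intro bexI[of _ "?D * Q'"] conjI mult_carrier_mat[of _ n n _ n]) auto
  qed
qed

lemma cond_number_fiedler_companion:
  assumes "1 \<le> n" "coeff p 0 = 1" "is_fiedler_companion n p F"
  shows "cond_number F = real n + (\<Sum>k\<in>{1..<n}. (coeff p k)\<^sup>2)"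
proof -
  obtain \<sigma> where \<sigma>: "distinct \<sigma>" "set \<sigma> = {..<n}" "equivalent_mat (fiedler_product n p \<sigma>) F"
    using assms(3) unfolding is_fiedler_companion_def by blast
  define N where "N = real n + (\<Sum>k\<in>{1..<n}. (coeff p k)\<^sup>2)"
  obtain G where G: "G \<in> carrier_mat n n" "fiedler_product n p \<sigma> \<in> carrier_mat n n"
    "fiedler_product n p \<sigma> * G = 1\<^sub>m n"
    "(frobenius_norm (fiedler_product n p \<sigma>))\<^sup>2 = N" "(frobenius_norm G)\<^sup>2 = N"
    using fiedler_product_norm[OF assms(1,2) \<sigma>(1,2)] unfolding N_def by blast
  then have "cond_number F = frobenius_norm (fiedler_product n p \<sigma>) * frobenius_norm G"
    using cond_number_equivalent[OF \<sigma>(3) G(2,1,3)] by blast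
  also have "frobenius_norm (fiedler_product n p \<sigma>) = frobenius_norm G"
    using G(4,5) frobenius_norm_nonneg power2_eq_iff_nonneg by metis
  finally show ?thesis using G(5) by (simp add: power2_eq_square N_def)
qed

section \<open>Striped companion matrices\<close>

lemma sum_list_take_mono:
  fixes t :: "nat list"
  assumes "a \<le> b"
  shows "sum_list (take a t) \<le> sum_list (take b t)"
proof -
  have "take b t = take a t @ take (b - a) (drop a t)"
    using take_add[of a "b - a" t] assms by simp
  then show ?thesis by simp
qed

lemma sum_list_take_Suc:
  fixes t :: "nat list"
  assumes "k < length t"
  shows "sum_list (take (Suc k) t) = sum_list (take k t) + t ! k"
  using assms by (simp add: take_Suc_conv_app_nth)

text \<open>The stripes occupy consecutive disjoint intervals of coefficient indices.\<close>

lemma stripe_coefficient_inj: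
  fixes t :: "nat list"
  assumes "k < length t" "k' < length t"
    and i: "i + 1 = sum_list (take (k + 1) t)" "j < t ! k"
    and i': "i' + 1 = sum_list (take (k' + 1) t)" "j' < t ! k'"
    and eq: "i - j = i' - j'"
  shows "i = i' \<and> j = j'"
proof -
  \<comment> \<open>For \<open>k < k'\<close> the offsets are separated by the sum of the first
    \<open>k'\<close> stripe sizes: \<open>i' - j'\<close> is at least this sum, which is at least
    \<open>i + 1\<close>, hence above \<open>i - j\<close>.\<close>
  have less: False if "k < k'" "k < length t" "k' < length t"
    "i + 1 = sum_list (take (k + 1) t)" "j < t ! k"
    "i' + 1 = sum_list (take (k' + 1) t)" "j' < t ! k'" "i - j = i' - j'" for k k' i i' j j'
  proof -
    have "sum_list (take (k + 1) t) \<le> sum_list (take k' t)"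
      using that(1) by (intro sum_list_take_mono) simp
    moreover have "i' + 1 = sum_list (take k' t) + t ! k'"
      using that sum_list_take_Suc[of k' t] by simp
    ultimately show False using that(4,5,7,8) by linarith
  qed
  have "k = k'"
    using less[of k k' i j i' j'] less[of k' k i' j' i j] assms by (metis linorder_neqE_nat)
  then have "i = i'" using i i' by simp
  \<comment> \<open>These bounds give \<open>j \<le> i\<close> and \<open>j' \<le> i'\<close>, so
    the subtractions in \<open>eq\<close> are not truncated.\<close>
  moreover have "t ! k \<le> i + 1" "t ! k' \<le> i' + 1"
    using i i' sum_list_take_Suc assms(1,2) by simp_all
  ultimately show ?thesis using eq i(2) i'(2) by linarith
qed

text \<open>The superdiagonal contributes \<open>n - 1\<close> ones. By injectivity of the
  coefficient index, each coefficient occurs at most once among the remaining entries.\<close>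

lemma frobenius_norm_striped_companion:
  assumes t: "stripe_sizes n t" and n: "1 \<le> n"
  shows "(frobenius_norm (striped_companion n p t))\<^sup>2 \<le> real (n - 1) + (\<Sum>k<n. (coeff p k)\<^sup>2)"
proof -
  define A where "A = {(i, j). i < n \<and> j < n \<and>
    (\<exists>k < length t. i + 1 = sum_list (take (k + 1) t) \<and> j < t ! k)}"
  define f where "f = (\<lambda>(i, j). n - 1 - (i - j))"
  let ?S = "striped_companion n p t"
  have S: "?S \<in> carrier_mat n n" by (simp add: striped_companion_def)
  \<comment> \<open>Coefficient entries lie on or below the diagonal, hence never on the
    superdiagonal, and the two kinds of entries can be summed separately.\<close>
  have le: "j \<le> i" if "(i, j) \<in> A" for i j
  proof -
    have "\<exists>k < length t. i + 1 = sum_list (take (k + 1) t) \<and> j < t ! k"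
      using that by (simp add: A_def)
    then obtain k where "k < length t" "i + 1 = sum_list (take (k + 1) t)" "j < t ! k" by blast
    moreover from this have "sum_list (take (k + 1) t) = sum_list (take k t) + t ! k"
      by (metis sum_list_take_Suc Suc_eq_plus1)
    ultimately show ?thesis by linarith
  qed
  have entry: "(?S $$ (i, j))\<^sup>2 = (if j = i + 1 then 1 else 0) +
      (if (i, j) \<in> A then (coeff p (f (i, j)))\<^sup>2 else 0)" if "i < n" "j < n" for i j
  proof (cases "j = i + 1")
    case True
    then have "(i, j) \<notin> A" using le by fastforce
    then show ?thesis using that True by (simp add: striped_companion_def)
  next
    case False
    then show ?thesis using that by (auto simp: striped_companion_def A_def f_def)
  qed
  have shift: "(\<Sum>i<n. \<Sum>j<n. if j = i + 1 then 1 else 0 :: real) = real (n - 1)"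
  proof -
    have "(\<Sum>i<n. \<Sum>j<n. if j = i + 1 then 1 else 0 :: real) = (\<Sum>i<n. if i \<in> {..<n - 1} then 1 else 0)"
      by (intro sum.cong refl) auto
    also have "\<dots> = (\<Sum>i\<in>{..<n} \<inter> {..<n - 1}. 1)" by (subst sum.inter_restrict) auto
    also have "{..<n} \<inter> {..<n - 1} = {..<n - 1}" by auto
    finally show ?thesis by simp
  qed
  have A: "A \<subseteq> {..<n} \<times> {..<n}" by (auto simp: A_def)
  then have fin: "finite A" by (rule finite_subset) simp
  have "(\<Sum>i<n. \<Sum>j<n. if (i, j) \<in> A then (coeff p (f (i, j)))\<^sup>2 else 0)
      = (\<Sum>x\<in>{..<n} \<times> {..<n}. if x \<in> A then (coeff p (f x))\<^sup>2 else 0)"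
    by (simp add: sum.cartesian_product)
  also have "\<dots> = (\<Sum>x\<in>A. (coeff p (f x))\<^sup>2)"
    using A by (simp add: sum.inter_restrict[symmetric] Int_absorb1)
  also have "\<dots> = (\<Sum>k\<in>f ` A. (coeff p k)\<^sup>2)"
  proof -
    have "inj_on f A"
    proof (rule inj_onI, clarify)
      fix i j i' j' assume ij: "(i, j) \<in> A" "(i', j') \<in> A" "f (i, j) = f (i', j')"
      then have "i < n" "i' < n" by (auto simp: A_def)
      with ij(3) have "i - j = i' - j'" by (simp add: f_def)
      with ij(1,2) show "i = i' \<and> j = j'" unfolding A_def
        using stripe_coefficient_inj by blast
    qed
    then show ?thesis by (simp add: sum.reindex)
  qed
  also have "\<dots> \<le> (\<Sum>k<n. (coeff p k)\<^sup>2)"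
    using n by (intro sum_mono2) (auto simp: f_def A_def)
  finally show ?thesis unfolding frobenius_norm_sq[OF S]
    using shift by (simp add: entry sum.distrib)
qed

text \<open>With \<open>u\<close> the first column and \<open>b\<close> the last row, S is the shift
  minus the outer product of \<open>u\<close> and \<open>b\<close>. The hypothesis
  \<open>disj\<close> kills every product \<open>b (i + 1) * u i\<close>, which makes the inverse
  explicit and no larger in norm than S.\<close>

lemma cond_number_shift_plus_rank_1:
  assumes S: "S \<in> carrier_mat n n" and n: "1 \<le> n"
    and rank: "\<And>i j. i < n \<Longrightarrow> j < n \<Longrightarrow>
      S $$ (i, j) = (if j = i + 1 then 1 else 0) - S $$ (i, 0) * S $$ (n - 1, j)"
    and corner: "S $$ (n - 1, 0) = - 1"
    and disj: "\<And>i. i + 1 < n \<Longrightarrow> S $$ (n - 1, i + 1) * S $$ (i, 0) = 0"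
  shows "cond_number S \<le> (frobenius_norm S)\<^sup>2"
proof -
  obtain l where l: "n = Suc l" using n by (cases n) auto
  define u where "u i = S $$ (i, 0)" for i
  define b where "b j = S $$ (l, j)" for j
  have Sij: "S $$ (i, j) = (if j = i + 1 then 1 else 0) - u i * b j" if "i < n" "j < n" for i j
    using rank[OF that] by (simp add: u_def b_def l)
  have ub: "u l = - 1" "b 0 = - 1" "\<And>i. i < l \<Longrightarrow> b (Suc i) * u i = 0"
    using corner disj by (auto simp: u_def b_def l)
  \<comment> \<open>T comes from solving S x = y. The last equation says b.x = y_l, so the others
    give x_(i+1) = y_i + u_i y_l. Inserting this into b.x = y_l, where b_0 = -1 and all b_(i+1) u_i
    vanish, yields x_0 as the sum of the b_(i+1) y_i minus y_l.\<close>
  define T where "T = mat n n (\<lambda>(i, j). case i of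
      0 \<Rightarrow> (if j = l then - 1 else b (Suc j))
    | Suc k \<Rightarrow> (if j = l then u k else if j = k then 1 else 0))"
  have T: "T \<in> carrier_mat n n" by (simp add: T_def)
  have T0: "T $$ (0, j) = (if j = l then - 1 else b (Suc j))" if "j < n" for j
    using that by (simp add: T_def l)
  have TS: "T $$ (Suc i, j) = (if j = l then u i else if j = i then 1 else 0)"
    if "i < l" "j < n" for i j using that by (simp add: T_def l)
  \<comment> \<open>The row vector \<open>b\<close> times T is the last unit vector, so the rank-one
    part of S affects only the last column of the product with T.\<close>
  have last: "(\<Sum>k<n. b k * T $$ (k, j)) = (if j = l then 1 else 0)" if j: "j < n" for j
  proof -
    have "(\<Sum>k<n. b k * T $$ (k, j)) = b 0 * T $$ (0, j) + (\<Sum>k<l. b (Suc k) * T $$ (Suc k, j))"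
      unfolding l by (rule sum.lessThan_Suc_shift)
    also have "(\<Sum>k<l. b (Suc k) * T $$ (Suc k, j)) = (\<Sum>k<l. if k = j then b (Suc j) else 0)"
      using ub(3) j by (intro sum.cong) (auto simp: TS)
    finally show ?thesis using j by (auto simp: T0 ub l)
  qed
  have "S * T = 1\<^sub>m n"
  proof (rule eq_matI, goal_cases)
    case (1 i j)
    then have ij: "i < n" "j < n" by simp_all
    have "(S * T) $$ (i, j) = (\<Sum>k<n. S $$ (i, k) * T $$ (k, j))"
      using S T ij by (simp add: scalar_prod_def atLeast0LessThan)
    also have "\<dots> = (\<Sum>k<n. (if k = Suc i then T $$ (k, j) else 0) - u i * (b k * T $$ (k, j)))"
      using ij by (intro sum.cong) (auto simp: Sij algebra_simps)
    also have "\<dots> = (\<Sum>k<n. if k = Suc i then T $$ (k, j) else 0) - u i * (if j = l then 1 else 0)"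
      by (simp only: sum_subtractf sum_distrib_left[symmetric] last[OF ij(2)])
    also have "\<dots> = 1\<^sub>m n $$ (i, j)"
    proof (cases "i = l")
      case True
      then show ?thesis using ij ub by (simp add: l)
    next
      case False
      then show ?thesis using ij by (auto simp: l TS)
    qed
    finally show ?case .
  qed (use S T in auto)
  then have "cond_number S = frobenius_norm S * frobenius_norm T"
    by (rule cond_number_eqI[OF S T])
  \<comment> \<open>Rows are matched cyclically: row 0 of T has the same sum of squares as the last
    row of S, and row \<open>i + 1\<close> of T is dominated by row \<open>i\<close> of S, which
    contains \<open>u i\<close> in column 0 and a 1 in column \<open>i + 1\<close>.\<close>
  moreover have "frobenius_norm T \<le> frobenius_norm S"
  proof (rule power2_le_imp_le[OF _ frobenius_norm_nonneg])
    have lastrow: "(\<Sum>j<n. (S $$ (l, j))\<^sup>2) = 1 + (\<Sum>j<l. (b (Suc j))\<^sup>2)"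
      unfolding l sum.lessThan_Suc_shift using ub by (simp add: b_def)
    have row: "1 + (u i)\<^sup>2 \<le> (\<Sum>j<n. (S $$ (i, j))\<^sup>2)" if "i < l" for i
    proof -
      have "S $$ (i, Suc i) = 1" using Sij[of i "Suc i"] ub(3)[OF that] that
        by (simp add: l mult.commute)
      then have "1 + (u i)\<^sup>2 = (\<Sum>j\<in>{0, Suc i}. (S $$ (i, j))\<^sup>2)" by (simp add: u_def)
      also have "\<dots> \<le> (\<Sum>j<n. (S $$ (i, j))\<^sup>2)" using that by (intro sum_mono2) (auto simp: l)
      finally show ?thesis .
    qed
    have "(frobenius_norm T)\<^sup>2 = (\<Sum>j<n. (T $$ (0, j))\<^sup>2) + (\<Sum>i<l. \<Sum>j<n. (T $$ (Suc i, j))\<^sup>2)"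
      unfolding frobenius_norm_sq[OF T] by (subst (1) l) (rule sum.lessThan_Suc_shift)
    also have "(\<Sum>j<n. (T $$ (0, j))\<^sup>2) = 1 + (\<Sum>j<l. (b (Suc j))\<^sup>2)"
      unfolding l by (simp add: T0 l)
    also have "(\<Sum>i<l. \<Sum>j<n. (T $$ (Suc i, j))\<^sup>2) = (\<Sum>i<l. 1 + (u i)\<^sup>2)"
    proof (rule sum.cong)
      fix i assume "i \<in> {..<l}"
      then have "(\<Sum>j<l. (T $$ (Suc i, j))\<^sup>2) = (\<Sum>j<l. if j = i then 1 else 0)"
        by (intro sum.cong) (auto simp: TS l)
      then show "(\<Sum>j<n. (T $$ (Suc i, j))\<^sup>2) = 1 + (u i)\<^sup>2"
        using \<open>i \<in> {..<l}\<close> by (simp add: l TS)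
    qed simp
    also have "1 + (\<Sum>j<l. (b (Suc j))\<^sup>2) + (\<Sum>i<l. 1 + (u i)\<^sup>2)
        \<le> (\<Sum>j<n. (S $$ (l, j))\<^sup>2) + (\<Sum>i<l. \<Sum>j<n. (S $$ (i, j))\<^sup>2)"
      unfolding lastrow using row by (intro add_mono sum_mono) auto
    also have "\<dots> = (frobenius_norm S)\<^sup>2"
      unfolding frobenius_norm_sq[OF S] by (simp add: l)
    finally show "(frobenius_norm T)\<^sup>2 \<le> (frobenius_norm S)\<^sup>2" .
  qed
  ultimately show ?thesis
    by (simp add: power2_eq_square mult_left_mono frobenius_norm_nonneg)
qed

text \<open>The stripe sizes add up to \<open>n\<close>, so the last stripe lies in the last row and
  begins with the constant coefficient.\<close>

lemma striped_companion_corner: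
  assumes t: "stripe_sizes n t" and n: "1 \<le> n"
  shows "striped_companion n p t $$ (n - 1, 0) = - coeff p 0"
proof -
  have "length t - 1 < length t" "n - 1 + 1 = sum_list (take (length t - 1 + 1) t)"
    "0 < t ! (length t - 1)"
    using t n by (auto simp: stripe_sizes_def)
  then have ex: "\<exists>k < length t. n - 1 + 1 = sum_list (take (k + 1) t) \<and> 0 < t ! k" by blast
  have "striped_companion n p t $$ (n - 1, 0) =
      (if \<exists>k < length t. n - 1 + 1 = sum_list (take (k + 1) t) \<and> 0 < t ! k
       then - coeff p (n - 1 - (n - 1 - 0)) else 0)"
    using n by (auto simp: striped_companion_def)
  then show ?thesis unfolding if_P[OF ex] by simp
qed

section \<open>Rank-one structure of the striped matrix and comparison of the condition
  numbers\<close>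

theorem corollary4p4:
  fixes n m :: nat and p :: "real poly" and t :: "nat list" and S R F :: "real mat"
  assumes "2 \<le> n"
    and "degree p = n" and "lead_coeff p = 1" and "coeff p 0 = 1"
    and "stripe_sizes n t" and "S = striped_companion n p t"
    and "m = hd t - 1" and "R \<in> carrier_mat (n - m) (m + 1)"
    and "S = four_block_mat (upper_shift_block m) (0\<^sub>m m (n - m - 1))
               R (lower_identity_block (n - m - 1))"
    and "vec_space.rank (n - m) R = 1"
    and "is_fiedler_companion n p F"
  shows "cond_number S \<le> cond_number F"
proof -
  have S: "S \<in> carrier_mat n n" by (simp add: assms(6) striped_companion_def)
  have "hd t \<le> n" "0 < hd t"
    using assms(5) member_le_sum_list[of "hd t" t] by (auto simp: stripe_sizes_def)
  then have m: "m < n" using assms(7) by simp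
  have block: "S $$ (i, j) = (if i < m then if j < m + 1 then if j = i + 1 then 1 else 0 else 0
      else if j < m + 1 then R $$ (i - m, j) else if j = i + 1 then 1 else 0)" if "i < n" "j < n" for i j
  proof -
    have "i < m + (n - m)" "j < (m + 1) + (n - m - 1)" using that m by auto
    then show ?thesis unfolding assms(9) using assms(8) that m
      by (auto simp: upper_shift_block_def lower_identity_block_def)
  qed
  have corner: "S $$ (n - 1, 0) = - 1"
    using striped_companion_corner[OF assms(5)] assms(1,4,6) by simp
  have top: "S $$ (i, 0) = 0" if "i < m" for i using block[of i 0] that m by simp
  have right: "S $$ (n - 1, j) = 0" if "m < j" "j < n" for j using block[of "n - 1" j] that m by auto
  \<comment> \<open>Above R the first column vanishes, and to the right of R the last row vanishes.
    In the first column and the last row the identity follows from the corner entry -1.\<close>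
  have shift: "S $$ (i, j) = (if j = i + 1 then 1 else 0) - S $$ (i, 0) * S $$ (n - 1, j)"
    if ij: "i < n" "j < n" for i j
  proof -
    consider "i < m" | "m < j" | "i = n - 1" | "j = 0" | "m \<le> i" "i < n - 1" "0 < j" "j \<le> m"
      using ij by linarith
    then show ?thesis
    proof cases
      \<comment> \<open>Here the entry lies inside R and below the superdiagonal. The minor of R
        that pairs it with the corner -1 expresses it as minus the product of its first-column and
        last-row entries.\<close>
      case 5
      have "R $$ (i - m, 0) * R $$ (n - 1 - m, j) = R $$ (i - m, j) * R $$ (n - 1 - m, 0)"
        using 5 m by (intro rank_1_minor[OF assms(8)]) (auto simp: assms(10))
      then have "S $$ (i, 0) * S $$ (n - 1, j) = S $$ (i, j) * S $$ (n - 1, 0)"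
        using 5 m ij by (simp add: block)
      then show ?thesis using corner 5 by simp
    qed (use block[OF ij] top right ij corner m in auto)
  qed
  \<comment> \<open>A nonzero second factor needs \<open>i \<ge> m\<close>, a nonzero first factor
    \<open>i + 1 \<le> m\<close>.\<close>
  have disj: "S $$ (n - 1, i + 1) * S $$ (i, 0) = 0" if "i + 1 < n" for i
    using top[of i] right[of "i + 1"] that by (cases "i < m") auto
  have "cond_number S \<le> (frobenius_norm S)\<^sup>2"
    using assms(1) by (intro cond_number_shift_plus_rank_1[OF S _ shift corner disj]) simp
  also have "\<dots> \<le> real (n - 1) + (\<Sum>k<n. (coeff p k)\<^sup>2)"
    unfolding assms(6) using assms(1) by (intro frobenius_norm_striped_companion[OF assms(5)]) simp
  \<comment> \<open>The summand at \<open>k = 0\<close> is 1 and completes \<open>n - 1\<close> to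
    \<open>n\<close>.\<close>
  also have "\<dots> = real n + (\<Sum>k\<in>{1..<n}. (coeff p k)\<^sup>2)"
  proof -
    have "{..<n} = insert 0 {1..<n}" using assms(1) by auto
    then show ?thesis using assms(1,4) by simp
  qed
  also have "\<dots> = cond_number F"
    using cond_number_fiedler_companion[of n p F] assms(1,4,11) by simp
  finally show ?thesis .
qed

end
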